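(* Let $n\ge 1$ be an integer. Then $D_{1,n,2}$ is a $\mathsf{TS}_2$-graph if and only if $n=3$.
   Context: Graphs are finite, simple and undirected. For a graph $G$, $\mathsf{TS}_2(G)$ is the graph whose nodes are all size-2 independent sets of $G$, two nodes $I,J$ being adjacent if there are vertices $u,v$ of $G$ with $I\setminus J=\{u\}$, $J\setminus I=\{v\}$ and $uv\in E(G)$. A graph is a $\mathsf{TS}_2$-graph if it is isomorphic to $\mathsf{TS}_2(G)$ for some graph $G$. For integers $n,r,s\ge 1$, $D_{r,n,s}$ is the tree obtained from the path $P_n$ on $n$ vertices by attaching $r$ leaves to one end vertex and $s$ leaves to the other end vertex (for $n=1$ both ends are the same vertex, so $D_{r,1,s}=K_{1,r+s}$). *)

theory Defs
  imports "Graph_Theory.Graph_Theory"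
begin

text \<open>
  A finite simple undirected graph is a \<^locale>\<open>pair_graph\<close>: the undirected edge \<open>uv\<close> is the
  pair of opposite arcs \<open>(u, v)\<close> and \<open>(v, u)\<close>.
\<close>

definition independent_set :: "'a pair_pre_digraph \<Rightarrow> 'a set \<Rightarrow> bool" where
  "independent_set G I \<longleftrightarrow> I \<subseteq> pverts G \<and> (\<forall>u\<in>I. \<forall>v\<in>I. (u, v) \<notin> parcs G)"

definition TS2_nodes :: "'a pair_pre_digraph \<Rightarrow> 'a set set" where
  "TS2_nodes G = {I. independent_set G I \<and> card I = 2}"

definition TS2 :: "'a pair_pre_digraph \<Rightarrow> 'a set pair_pre_digraph" where
  "TS2 G =
    \<lparr> pverts = TS2_nodes G,
      parcs = {(I, J). I \<in> TS2_nodes G \<and> J \<in> TS2_nodes G \<and>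
                 (\<exists>u v. I - J = {u} \<and> J - I = {v} \<and> (u, v) \<in> parcs G)} \<rparr>"

text \<open>
  A definition cannot quantify over the vertex type of \<open>G\<close>. Vertices are taken in \<^typ>\<open>nat\<close>, which
  loses nothing since \<open>G\<close> is finite: see \<open>is_TS2_graphI\<close> below.
\<close>

definition is_TS2_graph :: "'b pair_pre_digraph \<Rightarrow> bool" where
  "is_TS2_graph H \<longleftrightarrow>
    (\<exists>G :: nat pair_pre_digraph. pair_graph G \<and> digraph_iso (with_proj (TS2 G)) (with_proj H))"

datatype D_vertex = Path nat | LeafA nat | LeafB nat

text \<open>
  \<open>Path 1, \<dots>, Path n\<close> is the path; the \<open>r\<close> leaves \<open>LeafA i\<close> hang on \<open>Path 1\<close>, the \<open>s\<close> leaves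
  \<open>LeafB j\<close> on \<open>Path n\<close>. Only \<open>n \<ge> 1\<close> is meaningful. The set \<open>D_edges\<close> has one orientation of
  each edge.
\<close>

definition D_edges :: "nat \<Rightarrow> nat \<Rightarrow> nat \<Rightarrow> (D_vertex \<times> D_vertex) set" where
  "D_edges r n s =
    (\<lambda>i. (Path i, Path (Suc i))) ` {1..<n} \<union>
    (\<lambda>i. (LeafA i, Path 1)) ` {1..r} \<union>
    (\<lambda>j. (LeafB j, Path n)) ` {1..s}"

definition D :: "nat \<Rightarrow> nat \<Rightarrow> nat \<Rightarrow> D_vertex pair_pre_digraph" where
  "D r n s =
    \<lparr> pverts = Path ` {1..n} \<union> LeafA ` {1..r} \<union> LeafB ` {1..s},
      parcs = D_edges r n s \<union> (D_edges r n s)\<inverse> \<rparr>"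

lemma pair_graphI:
  assumes "finite (pverts G)"
    and "\<And>u v. (u, v) \<in> parcs G \<Longrightarrow> u \<in> pverts G \<and> v \<in> pverts G \<and> u \<noteq> v \<and> (v, u) \<in> parcs G"
  shows "pair_graph G"
proof -
  have "parcs G \<subseteq> pverts G \<times> pverts G"
    using assms(2) by auto
  then have "finite (parcs G)"
    using assms(1) finite_subset by blast
  then show ?thesis
    using assms by unfold_locales (auto simp: symmetric_def intro!: symI)
qed

lemma pair_graph_D:
  assumes "n \<ge> 1"
  shows "pair_graph (D r n s)"
  using assms by (intro pair_graphI) (auto simp: D_def D_edges_def)

lemma pair_graph_TS2:
  assumes "pair_graph G"
  shows "pair_graph (TS2 G)"
proof (rule pair_graphI)
  interpret pair_graph G by fact
  have "TS2_nodes G \<subseteq> Pow (pverts G)"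
    by (auto simp: TS2_nodes_def independent_set_def)
  then show "finite (pverts (TS2 G))"
    using pair_finite_verts by (auto simp: TS2_def intro: finite_subset)
  have "(v, u) \<in> parcs G" if "(u, v) \<in> parcs G" for u v
    using pair_sym_arcs that by (auto simp: symmetric_def elim: symE)
  then show "u \<in> pverts (TS2 G) \<and> v \<in> pverts (TS2 G) \<and> u \<noteq> v \<and> (v, u) \<in> parcs (TS2 G)"
    if "(u, v) \<in> parcs (TS2 G)" for u v
    using that by (auto simp: TS2_def)
qed

lemma digraph_iso_with_projI:
  assumes "pair_graph G" "inj_on f (pverts G)"
    and "pverts H = f ` pverts G" "parcs H = map_prod f f ` parcs G"
  shows "digraph_iso (with_proj G) (with_proj H)"
proof -
  interpret pair_graph G by fact
  have "parcs G \<subseteq> pverts G \<times> pverts G"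
    using in_arcsD1 in_arcsD2 by auto
  moreover have "inj_on (map_prod f f) (pverts G \<times> pverts G)"
    using assms(2) by (auto simp: inj_on_def)
  ultimately have "inj_on (map_prod f f) (parcs G)"
    using inj_on_subset by blast
  then show ?thesis
    unfolding digraph_iso_def
    using assms wf_digraph
    by (intro exI[of _ "\<lparr>iso_verts = f, iso_arcs = map_prod f f, iso_head = snd, iso_tail = fst\<rparr>"])
      (auto simp: digraph_isomorphism_def intro!: pre_digraph.equality)
qed

lemma parcs_TS2D: "(I, J) \<in> parcs (TS2 G) \<Longrightarrow> I \<in> TS2_nodes G \<and> J \<in> TS2_nodes G"
  by (simp add: TS2_def)

lemma is_TS2_graphI:
  fixes G :: "'a pair_pre_digraph"
  assumes "pair_graph G" "digraph_iso (with_proj (TS2 G)) (with_proj H)"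
  shows "is_TS2_graph H"
proof -
  interpret pair_graph G by fact
  obtain f :: "'a \<Rightarrow> nat" where f: "inj_on f (pverts G)"
    using finite_imp_inj_to_nat_seg[OF pair_finite_verts] by blast
  define K where "K = \<lparr>pverts = f ` pverts G, parcs = map_prod f f ` parcs G\<rparr>"
  have arcs: "u \<in> pverts G \<and> v \<in> pverts G \<and> u \<noteq> v \<and> (v, u) \<in> parcs G" if "(u, v) \<in> parcs G" for u v
    using that in_arcsD1 in_arcsD2 pair_no_loops[of "(u, v)"] pair_sym_arcs
    by (auto simp: symmetric_def elim: symE)
  have K: "pair_graph K"
  proof (rule pair_graphI)
    show "finite (pverts K)"
      using pair_finite_verts by (simp add: K_def)
    fix u v assume "(u, v) \<in> parcs K"
    then obtain a b where "u = f a" "v = f b" "(a, b) \<in> parcs G"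
      by (auto simp: K_def)
    then show "u \<in> pverts K \<and> v \<in> pverts K \<and> u \<noteq> v \<and> (v, u) \<in> parcs K"
      using arcs[of a b] f by (force simp: K_def dest: inj_onD)
  qed
  have K_arc: "(f u, f v) \<in> parcs K \<longleftrightarrow> (u, v) \<in> parcs G" if "u \<in> pverts G" "v \<in> pverts G" for u v
  proof
    assume "(f u, f v) \<in> parcs K"
    then obtain a b where ab: "f u = f a" "f v = f b" "(a, b) \<in> parcs G"
      by (auto simp: K_def)
    then have "u = a" "v = b"
      using arcs[OF ab(3)] that f by (auto dest: inj_onD)
    then show "(u, v) \<in> parcs G"
      using ab by simp
  qed (force simp: K_def)
  have ind: "independent_set K (f ` I) \<longleftrightarrow> independent_set G I" if "I \<subseteq> pverts G" for I
  proof -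
    have "f ` I \<subseteq> pverts K"
      using that by (auto simp: K_def)
    moreover have "(\<forall>u\<in>I. \<forall>v\<in>I. (f u, f v) \<notin> parcs K) \<longleftrightarrow> (\<forall>u\<in>I. \<forall>v\<in>I. (u, v) \<notin> parcs G)"
      using K_arc that by blast
    ultimately show ?thesis
      using that by (simp add: independent_set_def)
  qed
  have sub: "I \<subseteq> pverts G" if "I \<in> TS2_nodes G" for I
    using that by (auto simp: TS2_nodes_def independent_set_def)
  have node: "f ` I \<in> TS2_nodes K \<longleftrightarrow> I \<in> TS2_nodes G" if "I \<subseteq> pverts G" for I
    using ind[OF that] card_image[OF inj_on_subset[OF f that]] by (simp add: TS2_nodes_def)
  have nodes: "TS2_nodes K = (`) f ` TS2_nodes G"
  proof (intro equalityI subsetI)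
    fix J assume J: "J \<in> TS2_nodes K"
    then have "J \<subseteq> f ` pverts G"
      by (auto simp: TS2_nodes_def independent_set_def K_def)
    then obtain I where "I \<subseteq> pverts G" "J = f ` I"
      by (auto simp: subset_image_iff)
    then show "J \<in> (`) f ` TS2_nodes G"
      using node J by auto
  qed (use node sub in auto)
  have arc: "(f ` I, f ` J) \<in> parcs (TS2 K) \<longleftrightarrow> (I, J) \<in> parcs (TS2 G)"
    if I: "I \<in> TS2_nodes G" and J: "J \<in> TS2_nodes G" for I J
  proof -
    have diff: "f ` A - f ` B = f ` (A - B)" if "A \<in> TS2_nodes G" "B \<in> TS2_nodes G" for A B
      using sub[OF that(1)] sub[OF that(2)] inj_on_image_set_diff[OF f, of A B] by auto
    have *: "(\<exists>u v. f ` A = {u} \<and> f ` B = {v} \<and> (u, v) \<in> parcs K) \<longleftrightarrow>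
        (\<exists>u v. A = {u} \<and> B = {v} \<and> (u, v) \<in> parcs G)" (is "?L \<longleftrightarrow> ?R")
      if "A \<subseteq> pverts G" "B \<subseteq> pverts G" for A B
    proof
      assume ?L
      then obtain u v where uv: "f ` A = {u}" "f ` B = {v}" "(u, v) \<in> parcs K" by blast
      have "card A = 1" "card B = 1"
        using card_image[OF inj_on_subset[OF f that(1)]] card_image[OF inj_on_subset[OF f that(2)]] uv
        by auto
      then obtain a b where "A = {a}" "B = {b}" by (auto simp: card_1_singleton_iff)
      then show ?R using uv that K_arc by auto
    next
      assume ?R
      then show ?L using that K_arc by auto
    qed
    have "I - J \<subseteq> pverts G" "J - I \<subseteq> pverts G"
      using sub I J by blast+
    from *[OF this] show ?thesis
      using I J by (simp add: TS2_def nodes diff)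
  qed
  have TS2_arcs: "parcs (TS2 K) = map_prod ((`) f) ((`) f) ` parcs (TS2 G)"
  proof (intro equalityI subsetI)
    fix e assume e: "e \<in> parcs (TS2 K)"
    then have "fst e \<in> TS2_nodes K" "snd e \<in> TS2_nodes K"
      using parcs_TS2D[of "fst e" "snd e" K] by simp_all
    then obtain I J where IJ: "I \<in> TS2_nodes G" "J \<in> TS2_nodes G" "fst e = f ` I" "snd e = f ` J"
      unfolding nodes by blast
    then have "e = map_prod ((`) f) ((`) f) (I, J)" "(I, J) \<in> parcs (TS2 G)"
      using arc[OF IJ(1,2)] e by (simp_all add: prod_eq_iff flip: IJ(3,4))
    then show "e \<in> map_prod ((`) f) ((`) f) ` parcs (TS2 G)"
      by (rule image_eqI)
  next
    fix e assume "e \<in> map_prod ((`) f) ((`) f) ` parcs (TS2 G)"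
    then obtain I J where e: "e = (f ` I, f ` J)" "(I, J) \<in> parcs (TS2 G)"
      by auto
    then have "I \<in> TS2_nodes G" "J \<in> TS2_nodes G"
      using parcs_TS2D by blast+
    then show "e \<in> parcs (TS2 K)"
      using arc e by blast
  qed
  have "inj_on ((`) f) (TS2_nodes G)"
    using inj_on_image_Pow[OF f] by (rule inj_on_subset) (use sub in blast)
  then have "digraph_iso (with_proj (TS2 G)) (with_proj (TS2 K))"
    using pair_graph_TS2[OF assms(1)] TS2_arcs nodes
    by (intro digraph_iso_with_projI[where f = "(`) f"]) (simp_all add: TS2_def)
  moreover have "wf_digraph (with_proj (TS2 G))"
    using pair_graph_TS2[OF assms(1)]
    by (simp add: wf_digraph_wp_iff pair_graph_def pair_digraph_def pair_fin_digraph_def)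
  ultimately have "digraph_iso (with_proj (TS2 K)) (with_proj H)"
    using digraph_iso_swap digraph_iso_trans assms(2) by blast
  then show ?thesis
    using K by (auto simp: is_TS2_graph_def)
qed

end

theory Submission
  imports Defs
begin

text \<open>
  Let \<open>H\<close> be the complement of \<open>G\<close>. The nodes of \<open>TS2 G\<close> are the edges of \<open>H\<close>, and \<open>ab\<close>, \<open>ac\<close> are
  adjacent iff \<open>bc\<close> is not an edge of \<open>H\<close>. Suppose that \<open>TS2 G\<close> is \<open>D 1 n 2\<close> and let \<open>ab\<close> be its
  centre, the node of degree 3. If the two leaves at the centre were \<open>ac\<close> and \<open>ad\<close>, sharing the same
  end of \<open>ab\<close>, then \<open>cd\<close> would be an edge of \<open>H\<close>, hence a node, and any neighbour of \<open>cd\<close> would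
  give one of the leaves a second neighbour. So the leaves are \<open>ac\<close> and \<open>bd\<close>, and up to symmetry the third
  neighbour of the centre is \<open>ap\<close>. Then \<open>pc\<close> is a node all of whose neighbours are neighbours of \<open>ap\<close>
  other than \<open>ab\<close>, so \<open>pc\<close> ends the long leg two steps after \<open>ap\<close>: the leg has length 3.

  Conversely, for \<open>n = 3\<close> let \<open>H\<close> be a triangle with a pendant path of length 2 at one vertex and a
  pendant edge at another.
\<close>

section \<open>Nodes and arcs of \<open>TS2 G\<close> through the complement of
  \<open>G\<close>\<close>

declare One_nat_def [simp del]

text \<open>The edge relation of the complement graph, called \<open>H\<close> in the
  overview.\<close>

definition nonadj :: "'a pair_pre_digraph \<Rightarrow> 'a \<Rightarrow> 'a \<Rightarrow> bool" where
  "nonadj G u v \<longleftrightarrow> u \<in> pverts G \<and> v \<in> pverts G \<and> u \<noteq> v \<and> (u, v) \<notin> parcs G"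

lemma (in pair_graph) parcs_sym: "(u, v) \<in> parcs G \<longleftrightarrow> (v, u) \<in> parcs G"
  using pair_sym_arcs by (auto simp: symmetric_def elim: symE)

lemma (in pair_graph) parcs_irrefl: "(u, u) \<notin> parcs G"
  using pair_no_loops[of "(u, u)"] by auto

lemma (in pair_graph) nonadj_sym: "nonadj G u v \<longleftrightarrow> nonadj G v u"
  using parcs_sym by (auto simp: nonadj_def)

lemma nonadj_irrefl: "\<not> nonadj G u u"
  by (simp add: nonadj_def)

lemma (in pair_graph) doubleton_TS2_nodes: "{u, v} \<in> TS2_nodes G \<longleftrightarrow> nonadj G u v"
proof -
  have "card {u, v} = 2 \<longleftrightarrow> u \<noteq> v"
    by (cases "u = v") simp_all
  then show ?thesis
    using parcs_sym[of u v] parcs_irrefl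
    by (auto simp: TS2_nodes_def independent_set_def nonadj_def)
qed

lemma (in pair_graph) TS2_nodesE:
  assumes "I \<in> TS2_nodes G"
  obtains u v where "I = {u, v}" "nonadj G u v"
proof -
  obtain u v where "I = {u, v}"
    using assms by (auto simp: TS2_nodes_def card_2_iff)
  then show ?thesis
    using that assms doubleton_TS2_nodes by blast
qed

lemma (in pair_graph) TS2_arcI:
  assumes "nonadj G a b" "nonadj G a c" "b \<noteq> c" "\<not> nonadj G b c"
  shows "({a, b}, {a, c}) \<in> parcs (TS2 G)"
proof -
  have "{a, b} - {a, c} = {b}" "{a, c} - {a, b} = {c}" "(b, c) \<in> parcs G"
    using assms by (auto simp: nonadj_def)
  then show ?thesis
    using assms by (auto simp: TS2_def doubleton_TS2_nodes)
qed

text \<open>An arc moves one vertex of \<open>{a, b}\<close> and keeps the other; the two cases say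
  which one is kept.\<close>

lemma (in pair_graph) TS2_arcE:
  assumes "(I, J) \<in> parcs (TS2 G)" "I = {a, b}"
  obtains c where "J = {a, c}" "nonadj G a b" "nonadj G a c" "b \<noteq> c" "\<not> nonadj G b c"
  | c where "J = {b, c}" "nonadj G a b" "nonadj G b c" "a \<noteq> c" "\<not> nonadj G a c"
proof -
  obtain u v where uv: "I - J = {u}" "J - I = {v}" "(u, v) \<in> parcs G"
    and IJ: "I \<in> TS2_nodes G" "J \<in> TS2_nodes G"
    using assms(1) by (auto simp: TS2_def)
  have ab: "nonadj G a b"
    using IJ(1) assms(2) doubleton_TS2_nodes by blast
  have neq: "u \<noteq> v" "\<not> nonadj G u v"
    using uv by (auto simp: nonadj_def)
  obtain x y where J: "J = {x, y}" "nonadj G x y"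
    using IJ(2) by (rule TS2_nodesE)
  have "u = a \<and> J = {b, v} \<or> u = b \<and> J = {a, v}"
  proof -
    have "a \<noteq> b"
      using ab by (simp add: nonadj_def)
    moreover have "u \<in> I" "u \<notin> J" "v \<in> J" "v \<notin> I" and "w \<in> I \<Longrightarrow> w \<noteq> u \<Longrightarrow> w \<in> J" for w
      using set_eq_iff[THEN iffD1, OF uv(1)] set_eq_iff[THEN iffD1, OF uv(2)] by auto
    ultimately have "u = a \<and> b \<in> J \<or> u = b \<and> a \<in> J" "v \<in> J" "v \<noteq> a" "v \<noteq> b"
      unfolding assms(2) by auto
    then show ?thesis
      unfolding J(1) by (elim disjE conjE) auto
  qed
  then show ?thesis
  proof (elim disjE conjE)
    assume "u = a" "J = {b, v}"
    then show ?thesis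
      using that(2)[of v] ab neq IJ(2) doubleton_TS2_nodes by simp
  next
    assume "u = b" "J = {a, v}"
    then show ?thesis
      using that(1)[of v] ab neq IJ(2) doubleton_TS2_nodes by simp
  qed
qed

lemma (in pair_graph) TS2_arcD:
  assumes "({a, b}, {a, c}) \<in> parcs (TS2 G)"
  shows "nonadj G a b" "nonadj G a c" "b \<noteq> c" "\<not> nonadj G b c"
proof -
  have "nonadj G a b \<and> nonadj G a c \<and> b \<noteq> c \<and> \<not> nonadj G b c"
    using assms
  proof (rule TS2_arcE[OF _ refl])
    fix x assume "{a, c} = {a, x}" "nonadj G a b" "nonadj G a x" "b \<noteq> x" "\<not> nonadj G b x"
    moreover from this have "c = x"
      by (auto simp: doubleton_eq_iff)
    ultimately show ?thesis
      by simp
  next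
    \<comment> \<open>Keeping \<open>b\<close> instead of \<open>a\<close> would force
      \<open>a = b\<close>.\<close>
    fix x assume "{a, c} = {b, x}" "nonadj G a b" "a \<noteq> x"
    then show ?thesis
      by (simp add: doubleton_eq_iff nonadj_irrefl)
  qed
  then show "nonadj G a b" "nonadj G a c" "b \<noteq> c" "\<not> nonadj G b c"
    by simp_all
qed

section \<open>Local structure around the centre \<open>ab\<close>\<close>

lemma (in pair_graph) TS2_leaves_opposite:
  assumes z: "({a, b}, {a, c}) \<in> parcs (TS2 G)" "({a, b}, {a, d}) \<in> parcs (TS2 G)"
    and "c \<noteq> d"
    and leaf_c: "\<And>J. ({a, c}, J) \<in> parcs (TS2 G) \<Longrightarrow> J = {a, b}"
    and leaf_d: "\<And>J. ({a, d}, J) \<in> parcs (TS2 G) \<Longrightarrow> J = {a, b}"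
    and nonisolated: "\<And>I. I \<in> TS2_nodes G \<Longrightarrow> \<exists>J. (I, J) \<in> parcs (TS2 G)"
  shows False
proof -
  \<comment> \<open>A neighbour \<open>cx\<close> of \<open>cd\<close> is impossible: if
    \<open>ax\<close> is a node, it is a second neighbour of \<open>ad\<close>; if not,
    \<open>cx\<close> is a second neighbour of \<open>ac\<close>. The claim is general in
    \<open>c\<close> and \<open>d\<close> because it is also used with them exchanged.\<close>
  have sub: False
    if "nonadj G a c" "nonadj G a d" "nonadj G c x" "\<not> nonadj G d x" "d \<noteq> x"
      "x \<noteq> b" "x \<noteq> a" "a \<noteq> b"
      "\<And>J. ({a, c}, J) \<in> parcs (TS2 G) \<Longrightarrow> J = {a, b}"
      "\<And>J. ({a, d}, J) \<in> parcs (TS2 G) \<Longrightarrow> J = {a, b}" for c d x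
  proof (cases "nonadj G a x")
    case True
    then have "({a, d}, {a, x}) \<in> parcs (TS2 G)"
      using that by (intro TS2_arcI) auto
    then show False
      using that by (metis doubleton_eq_iff)
  next
    case False
    then have "({c, a}, {c, x}) \<in> parcs (TS2 G)"
      using that nonadj_sym by (intro TS2_arcI) auto
    then have "{c, x} = {a, b}"
      using that by (metis insert_commute)
    then show False
      using that by (auto simp: doubleton_eq_iff nonadj_def)
  qed
  have b: "nonadj G a b" "nonadj G a c" "nonadj G a d" "\<not> nonadj G b c" "\<not> nonadj G b d"
    "b \<noteq> c" "b \<noteq> d"
    using TS2_arcD[OF z(1)] TS2_arcD[OF z(2)] by simp_all
  \<comment> \<open>Otherwise the leaves \<open>ac\<close> and \<open>ad\<close> would be adjacent
    to each other.\<close>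
  have "nonadj G c d"
    using TS2_arcI[of a c d] leaf_c[of "{a, d}"] b assms(3) by (auto simp: doubleton_eq_iff)
  then obtain J where "({c, d}, J) \<in> parcs (TS2 G)"
    using nonisolated doubleton_TS2_nodes by blast
  then show False
  proof (rule TS2_arcE[OF _ refl])
    fix x assume "nonadj G c x" "d \<noteq> x" "\<not> nonadj G d x"
    moreover have "x \<noteq> b" "x \<noteq> a" "a \<noteq> b"
      using calculation b nonadj_sym by metis+
    ultimately show False
      using sub[of c d x] b leaf_c leaf_d by blast
  next
    fix x assume "nonadj G d x" "c \<noteq> x" "\<not> nonadj G c x"
    moreover have "x \<noteq> b" "x \<noteq> a" "a \<noteq> b"
      using calculation b nonadj_sym by metis+
    ultimately show False
      using sub[of d c x] b leaf_c leaf_d by blast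
  qed
qed

text \<open>Since \<open>a\<close>, \<open>p\<close>, \<open>c\<close> form a triangle in the
  complement, a move of \<open>pc\<close> that keeps \<open>p\<close> can be matched from
  \<open>ap\<close>, or else the leaf \<open>ac\<close> gains a neighbour. A move that keeps
  \<open>c\<close> creates a second node with three neighbours.\<close>

lemma (in pair_graph) TS2_triangle_neighbours:
  assumes z: "\<And>J. ({a, b}, J) \<in> parcs (TS2 G) \<longleftrightarrow> J \<in> {{a, p}, {a, c}, {b, d}}"
    and "p \<noteq> c"
    and leaf_c: "\<And>J. ({a, c}, J) \<in> parcs (TS2 G) \<Longrightarrow> J = {a, b}"
    and leaf_d: "\<And>J. ({b, d}, J) \<in> parcs (TS2 G) \<Longrightarrow> J = {a, b}"
    and deg3: "\<And>I J K L. \<lbrakk>(I, J) \<in> parcs (TS2 G); (I, K) \<in> parcs (TS2 G); (I, L) \<in> parcs (TS2 G);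
      J \<noteq> K; J \<noteq> L; K \<noteq> L\<rbrakk> \<Longrightarrow> I = {a, b}"
  shows "{p, c} \<in> TS2_nodes G"
    and "\<And>J. ({p, c}, J) \<in> parcs (TS2 G) \<Longrightarrow> ({a, p}, J) \<in> parcs (TS2 G) \<and> J \<noteq> {a, b}"
proof -
  have arcs: "({a, b}, {a, p}) \<in> parcs (TS2 G)" "({a, b}, {a, c}) \<in> parcs (TS2 G)"
    "({b, a}, {b, d}) \<in> parcs (TS2 G)"
    using z by (simp_all add: insert_commute)
  have e: "nonadj G a b" "nonadj G a p" "nonadj G a c" "nonadj G b d"
    "\<not> nonadj G b p" "\<not> nonadj G b c" "\<not> nonadj G a d" "b \<noteq> p" "b \<noteq> c" "a \<noteq> d"
    using TS2_arcD[OF arcs(1)] TS2_arcD[OF arcs(2)] TS2_arcD[OF arcs(3)] by simp_all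
  then have e': "a \<noteq> b" "a \<noteq> p" "a \<noteq> c" "b \<noteq> d" "d \<noteq> c" "d \<noteq> p"
    using nonadj_irrefl by metis+
  note sym = nonadj_sym
  have pc: "nonadj G p c"
    using TS2_arcI[of a c p] leaf_c[of "{a, p}"] e assms(2) sym by (auto simp: doubleton_eq_iff)
  then show "{p, c} \<in> TS2_nodes G"
    using doubleton_TS2_nodes by blast
  have cd: "\<not> nonadj G c d"
  proof
    assume "nonadj G c d"
    then have "({c, a}, {c, d}) \<in> parcs (TS2 G)"
      using e e' sym by (intro TS2_arcI) auto
    then show False
      using leaf_c[of "{c, d}"] e e' by (auto simp: doubleton_eq_iff insert_commute)
  qed
  fix J assume "({p, c}, J) \<in> parcs (TS2 G)"
  then show "({a, p}, J) \<in> parcs (TS2 G) \<and> J \<noteq> {a, b}"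
  proof (rule TS2_arcE[OF _ refl])
    fix x assume x: "J = {p, x}" "nonadj G p x" "c \<noteq> x" "\<not> nonadj G c x"
    have "\<not> nonadj G a x"
    proof
      assume "nonadj G a x"
      then have "({a, c}, {a, x}) \<in> parcs (TS2 G)"
        using e x by (intro TS2_arcI) auto
      then show False
        using leaf_c[of "{a, x}"] e e' x sym by (auto simp: doubleton_eq_iff)
    qed
    moreover have "a \<noteq> x" "p \<noteq> x"
      using e x sym nonadj_irrefl by metis+
    ultimately have "({p, a}, {p, x}) \<in> parcs (TS2 G)"
      using e x sym by (intro TS2_arcI) auto
    then show ?thesis
      using x e e' by (auto simp: insert_commute doubleton_eq_iff)
  next
    \<comment> \<open>This case is contradictory. In turn \<open>x\<close> is joined in the
      complement to \<open>a\<close>, \<open>b\<close> and \<open>d\<close>, as otherwise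
      \<open>ac\<close>, \<open>ab\<close> or \<open>bd\<close> would have a neighbour too
      many.\<close>
    fix x assume x: "J = {c, x}" "nonadj G c x" "p \<noteq> x" "\<not> nonadj G p x"
    have x': "x \<noteq> a" "x \<noteq> b" "x \<noteq> c" "x \<noteq> d"
      using e x cd sym nonadj_irrefl by metis+
    have ax: "nonadj G a x"
    proof (rule ccontr)
      assume "\<not> nonadj G a x"
      then have "({c, a}, {c, x}) \<in> parcs (TS2 G)"
        using e x x' sym by (intro TS2_arcI) auto
      then show False
        using leaf_c[of "{c, x}"] e e' x' by (auto simp: doubleton_eq_iff insert_commute)
    qed
    have bx: "nonadj G b x"
    proof (rule ccontr)
      assume "\<not> nonadj G b x"
      then have "({a, b}, {a, x}) \<in> parcs (TS2 G)"
        using e x x' ax sym by (intro TS2_arcI) auto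
      then show False
        using z[of "{a, x}"] e e' x x' by (auto simp: doubleton_eq_iff)
    qed
    have dx: "nonadj G d x"
    proof (rule ccontr)
      assume "\<not> nonadj G d x"
      then have "({b, d}, {b, x}) \<in> parcs (TS2 G)"
        using e x x' bx sym by (intro TS2_arcI) auto
      then show False
        using leaf_d[of "{b, x}"] e e' x' by (auto simp: doubleton_eq_iff)
    qed
    \<comment> \<open>Now \<open>xc\<close> has the three neighbours \<open>xb\<close>, \<open>xd\<close>, \<open>cp\<close>, but it is not the centre.\<close>
    have "({x, c}, {x, b}) \<in> parcs (TS2 G)" "({x, c}, {x, d}) \<in> parcs (TS2 G)"
      "({c, x}, {c, p}) \<in> parcs (TS2 G)"
      using e e' x x' bx dx cd pc sym by (auto intro!: TS2_arcI)
    then have "{x, c} = {a, b}"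
      using deg3[of "{x, c}" "{x, b}" "{x, d}" "{c, p}"] e e' x x'
      by (auto simp: doubleton_eq_iff insert_commute)
    then show ?thesis
      using x' by (auto simp: doubleton_eq_iff)
  qed
qed

section \<open>Neighbourhoods in the tree \<open>D 1 n 2\<close>\<close>

text \<open>The neighbour of the centre \<open>Path n\<close> on the long leg. For
  \<open>n = 1\<close> the leg is just the leaf \<open>LeafA 1\<close>.\<close>

definition leg_start :: "nat \<Rightarrow> D_vertex" where
  "leg_start n = (if n = 1 then LeafA 1 else Path (n - 1))"

text \<open>Merging both orientations and splitting on the tail turns adjacency in the tree into
  arithmetic of indices.\<close>

lemma D_arc_iff:
  assumes "n \<ge> 1"
  shows "(u, v) \<in> parcs (D 1 n 2) \<longleftrightarrow>
    (case u of
      Path i \<Rightarrow> 1 \<le> i \<and> i \<le> n \<and>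
        (v = Path (Suc i) \<and> i < n \<or> v = Path (i - 1) \<and> 1 < i \<or> v = LeafA 1 \<and> i = 1 \<or>
          (v = LeafB 1 \<or> v = LeafB 2) \<and> i = n)
    | LeafA i \<Rightarrow> i = 1 \<and> v = Path 1
    | LeafB i \<Rightarrow> (i = 1 \<or> i = 2) \<and> v = Path n)"
proof -
  have "{1..2::nat} = {1, 2}" by auto
  then show ?thesis
    using assms
    by (cases u; cases v) (auto simp: D_def D_edges_def image_iff)
qed

lemma D_centre_neighbours:
  assumes "n \<ge> 1"
  shows "(Path n, v) \<in> parcs (D 1 n 2) \<longleftrightarrow> v \<in> {leg_start n, LeafB 1, LeafB 2}"
  using assms by (auto simp: D_arc_iff leg_start_def)

lemma D_nonisolated:
  assumes "n \<ge> 1" "u \<in> pverts (D 1 n 2)"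
  shows "\<exists>v. (u, v) \<in> parcs (D 1 n 2)"
proof (cases u)
  case (Path i)
  then have "(u, if i = n then LeafB 1 else Path (Suc i)) \<in> parcs (D 1 n 2)"
    using assms(2) by (auto simp: D_arc_iff[OF assms(1)]) (auto simp: D_def)
  then show ?thesis ..
next
  case (LeafA i)
  then have "(u, Path 1) \<in> parcs (D 1 n 2)"
    using assms(2) by (auto simp: D_arc_iff[OF assms(1)]) (auto simp: D_def)
  then show ?thesis ..
next
  case (LeafB i)
  then have "(u, Path n) \<in> parcs (D 1 n 2)"
    using assms(2) by (auto simp: D_arc_iff[OF assms(1)]) (auto simp: D_def)
  then show ?thesis ..
qed

lemma D_three_neighbours:
  assumes "n \<ge> 1" "(u, v) \<in> parcs (D 1 n 2)" "(u, w) \<in> parcs (D 1 n 2)" "(u, x) \<in> parcs (D 1 n 2)"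
    and "v \<noteq> w" "v \<noteq> x" "w \<noteq> x"
  shows "u = Path n"
  using assms by (cases u) (auto simp: D_arc_iff)

text \<open>Besides \<open>Path n\<close>, \<open>leg_start n\<close> has at most one neighbour, so
  \<open>u\<close> must be a leaf. It does not hang on \<open>Path n\<close>, so it is
  \<open>LeafA 1\<close>, and \<open>Path 1\<close> is the vertex just beyond
  \<open>leg_start n\<close>.\<close>

lemma D_short_leg:
  assumes "n \<ge> 1" "(u, v) \<in> parcs (D 1 n 2)"
    and sub: "\<And>w. (u, w) \<in> parcs (D 1 n 2) \<Longrightarrow> (leg_start n, w) \<in> parcs (D 1 n 2) \<and> w \<noteq> Path n"
  shows "n = 3"
proof (cases u)
  case (Path i)
  \<comment> \<open>Two distinct neighbours of a path vertex, one in each direction.\<close>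
  have "(u, if i = n then LeafB 1 else Path (Suc i)) \<in> parcs (D 1 n 2)"
    "(u, if i = 1 then LeafA 1 else Path (i - 1)) \<in> parcs (D 1 n 2)"
    using assms(1,2) Path by (auto simp: D_arc_iff)
  from this[THEN sub] show ?thesis
    using assms(1,2) Path by (auto simp: D_arc_iff leg_start_def split: if_splits)
next
  case (LeafA i)
  then show ?thesis
    using assms(1,2) sub[of "Path 1"] by (auto simp: D_arc_iff leg_start_def split: if_splits)
next
  case (LeafB i)
  then show ?thesis
    using assms(1,2) sub[of "Path n"] by (auto simp: D_arc_iff)
qed

section \<open>Necessity of \<open>n = 3\<close>\<close>

text \<open>A digraph isomorphism has a separate arc map. Because head and tail are
  \<open>snd\<close> and \<open>fst\<close> on both sides, that map is forced to act coordinatewise,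
  which leaves only a vertex bijection.\<close>

lemma digraph_iso_with_projE:
  assumes "digraph_iso (with_proj G) (with_proj H)" "pair_graph G"
  obtains f where "bij_betw f (pverts G) (pverts H)"
    "\<And>u v. \<lbrakk>u \<in> pverts G; v \<in> pverts G\<rbrakk> \<Longrightarrow> (f u, f v) \<in> parcs H \<longleftrightarrow> (u, v) \<in> parcs G"
proof -
  interpret pair_graph G by fact
  obtain h where h: "digraph_isomorphism h" "with_proj H = app_iso h (with_proj G)"
    using assms(1) by (auto simp: digraph_iso_def)
  let ?f = "iso_verts h"
  have inj: "inj_on ?f (pverts G)"
    using h(1) by (simp add: digraph_isomorphism_def)
  have V: "pverts H = ?f ` pverts G"
    using arg_cong[OF h(2), of verts] by simp
  have arc: "iso_arcs h (u, v) = (?f u, ?f v)" if "(u, v) \<in> parcs G" for u v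
  proof -
    have "iso_head h (iso_arcs h (u, v)) = ?f v" "iso_tail h (iso_arcs h (u, v)) = ?f u"
      using h(1) that by (auto simp: digraph_isomorphism_def)
    moreover have "iso_head h = snd" "iso_tail h = fst"
      using arg_cong[OF h(2), of head] arg_cong[OF h(2), of tail] by (simp_all add: app_iso_def)
    ultimately show ?thesis
      by (simp add: prod_eq_iff)
  qed
  have A: "parcs H = iso_arcs h ` parcs G"
    using arg_cong[OF h(2), of arcs] by simp
  show ?thesis
  proof (rule that)
    show "bij_betw ?f (pverts G) (pverts H)"
      using inj V by (simp add: bij_betw_def)
    fix u v assume uv: "u \<in> pverts G" "v \<in> pverts G"
    show "(?f u, ?f v) \<in> parcs H \<longleftrightarrow> (u, v) \<in> parcs G"
    proof
      assume "(?f u, ?f v) \<in> parcs H"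
      then obtain x y where xy: "(x, y) \<in> parcs G" "(?f u, ?f v) = iso_arcs h (x, y)"
        unfolding A by auto
      then have "?f u = ?f x" "?f v = ?f y" "x \<in> pverts G" "y \<in> pverts G"
        using arc[OF xy(1)] in_arcsD1 in_arcsD2 by auto
      then show "(u, v) \<in> parcs G"
        using inj_onD[OF inj] uv xy(1) by metis
    next
      assume uv: "(u, v) \<in> parcs G"
      show "(?f u, ?f v) \<in> parcs H"
        unfolding A arc[OF uv, symmetric] using uv by (rule imageI)
    qed
  qed
qed

lemma is_TS2_graph_D_imp:
  assumes "n \<ge> 1" "is_TS2_graph (D 1 n 2)"
  shows "n = 3"
proof -
  obtain G :: "nat pair_pre_digraph" where G: "pair_graph G"
    and iso: "digraph_iso (with_proj (TS2 G)) (with_proj (D 1 n 2))"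
    using assms(2) by (auto simp: is_TS2_graph_def)
  interpret pair_graph G by fact
  obtain h where h: "bij_betw h (TS2_nodes G) (pverts (D 1 n 2))"
    and arc: "\<And>I J. \<lbrakk>I \<in> TS2_nodes G; J \<in> TS2_nodes G\<rbrakk> \<Longrightarrow>
      (h I, h J) \<in> parcs (D 1 n 2) \<longleftrightarrow> (I, J) \<in> parcs (TS2 G)"
    using digraph_iso_with_projE[OF iso pair_graph_TS2[OF G]] by (auto simp: TS2_def)
  interpret D: pair_graph "D 1 n 2"
    using assms(1) by (rule pair_graph_D)
  \<comment> \<open>\<open>g\<close> names the node of \<open>TS2 G\<close> that stands for a given
    tree vertex.\<close>
  define g where "g = the_inv_into (TS2_nodes G) h"
  have g: "g u \<in> TS2_nodes G" "h (g u) = u" if "u \<in> pverts (D 1 n 2)" for u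
    using that h by (auto simp: g_def bij_betw_def the_inv_into_into f_the_inv_into_f)
  have gh: "g (h I) = I" and hV: "h I \<in> pverts (D 1 n 2)" if "I \<in> TS2_nodes G" for I
    using that h by (auto simp: g_def bij_betw_def the_inv_into_f_f)
  have nbr: "(g u, J) \<in> parcs (TS2 G) \<longleftrightarrow> (\<exists>v. J = g v \<and> (u, v) \<in> parcs (D 1 n 2))"
    if "u \<in> pverts (D 1 n 2)" for u J
    using that g gh hV arc parcs_TS2D D.in_arcsD2 by metis
  have V: "Path n \<in> pverts (D 1 n 2)" "leg_start n \<in> pverts (D 1 n 2)"
    "LeafB 1 \<in> pverts (D 1 n 2)" "LeafB 2 \<in> pverts (D 1 n 2)"
    using assms(1) by (auto simp: D_def leg_start_def)
  have z: "(g (Path n), J) \<in> parcs (TS2 G) \<longleftrightarrow> J \<in> {g (leg_start n), g (LeafB 1), g (LeafB 2)}" for J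
    using nbr[OF V(1)] D_centre_neighbours[OF assms(1)] by auto
  have leaf: "J = g (Path n)" if "(g (LeafB i), J) \<in> parcs (TS2 G)" "i \<in> {1, 2}" for i J
    using that nbr[of "LeafB i"] V assms(1) by (auto simp: D_arc_iff)
  have ne: "g (leg_start n) \<noteq> g (LeafB 1)" "g (leg_start n) \<noteq> g (LeafB 2)" "g (LeafB 1) \<noteq> g (LeafB 2)"
    using g(2)[OF V(2)] g(2)[OF V(3)] g(2)[OF V(4)] by (auto simp: leg_start_def split: if_splits)
  have nonisolated: "\<exists>J. (I, J) \<in> parcs (TS2 G)" if "I \<in> TS2_nodes G" for I
    using D_nonisolated[OF assms(1) hV[OF that]] nbr[OF hV[OF that]] gh[OF that] by metis
  have deg3: "I = g (Path n)" if "(I, J) \<in> parcs (TS2 G)" "(I, K) \<in> parcs (TS2 G)"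
    "(I, L) \<in> parcs (TS2 G)" "J \<noteq> K" "J \<noteq> L" "K \<noteq> L" for I J K L
  proof -
    have I: "I \<in> TS2_nodes G"
      using that parcs_TS2D by blast
    then have "h I = Path n"
      using that nbr[OF hV[OF I]] gh D_three_neighbours[OF assms(1), of "h I"] by metis
    then show ?thesis
      using gh[OF I] by simp
  qed
  \<comment> \<open>The normalised situation: leaves at opposite ends, and the leg starting at the
    end called \<open>a\<close>. The indices \<open>i\<close>, \<open>j\<close> leave open which
    leaf is at \<open>a\<close>, so that \<open>a\<close> and \<open>b\<close> can be swapped
    later.\<close>
  have finish: "n = 3"
    if ab: "g (Path n) = {a, b}" and p: "g (leg_start n) = {a, p}"
      and L: "g (LeafB i) = {a, c}" "g (LeafB j) = {b, d}" "{i, j} = {1, 2}" for a b p c d i j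
  proof -
    have ij: "i = 1 \<and> j = 2 \<or> i = 2 \<and> j = 1"
      using L(3) by (auto simp: doubleton_eq_iff)
    have LeafBs: "{g (LeafB 1), g (LeafB 2)} = {g (LeafB i), g (LeafB j)}"
      using ij by (elim disjE) (simp_all add: insert_commute)
    have 1: "({a, b}, J) \<in> parcs (TS2 G) \<longleftrightarrow> J \<in> {{a, p}, {a, c}, {b, d}}" for J
      using z[of J] unfolding LeafBs ab p L(1,2) .
    have 2: "p \<noteq> c"
      using ne ij p L(1) by metis
    have ij': "i \<in> {1, 2}" "j \<in> {1, 2}"
      using ij by auto
    have 3: "({a, c}, J) \<in> parcs (TS2 G) \<Longrightarrow> J = {a, b}"
      "({b, d}, J) \<in> parcs (TS2 G) \<Longrightarrow> J = {a, b}" for J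
      using leaf[OF _ ij'(1)] leaf[OF _ ij'(2)] unfolding L(1,2) ab by blast+
    note T = TS2_triangle_neighbours[OF 1 2 3 deg3[unfolded ab]]
    \<comment> \<open>The tree vertex represented by \<open>pc\<close>; it plays the role of
      \<open>u\<close> in \<open>D_short_leg\<close>.\<close>
    let ?u = "h {p, c}"
    have u: "g ?u = {p, c}" "?u \<in> pverts (D 1 n 2)"
      using T(1) gh hV by auto
    obtain v where v: "(?u, v) \<in> parcs (D 1 n 2)"
      using D_nonisolated[OF assms(1) u(2)] by blast
    show ?thesis
    proof (rule D_short_leg[OF assms(1) v])
      fix w assume w: "(?u, w) \<in> parcs (D 1 n 2)"
      then have "({p, c}, g w) \<in> parcs (TS2 G)"
        using nbr[OF u(2)] u(1) by auto
      then have "(g (leg_start n), g w) \<in> parcs (TS2 G)" "g w \<noteq> g (Path n)"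
        using T(2) p ab by auto
      then show "(leg_start n, w) \<in> parcs (D 1 n 2) \<and> w \<noteq> Path n"
        using nbr[OF V(2)] g(2) D.in_arcsD2 w by metis
    qed
  qed
  obtain a b where ab: "g (Path n) = {a, b}"
    using g(1)[OF V(1)] TS2_nodesE by metis
  have same: False
    if "g (Path n) = {a, b}" "g (LeafB 1) = {a, c}" "g (LeafB 2) = {a, d}" for a b c d
  proof (rule TS2_leaves_opposite)
    show "({a, b}, {a, c}) \<in> parcs (TS2 G)" "({a, b}, {a, d}) \<in> parcs (TS2 G)"
      using z that by auto
    show "c \<noteq> d"
      using ne that by auto
    show "J = {a, b}" if "({a, c}, J) \<in> parcs (TS2 G)" for J
      using leaf[of 1 J] that \<open>g (Path n) = {a, b}\<close> \<open>g (LeafB 1) = {a, c}\<close> by simp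
    show "J = {a, b}" if "({a, d}, J) \<in> parcs (TS2 G)" for J
      using leaf[of 2 J] that \<open>g (Path n) = {a, b}\<close> \<open>g (LeafB 2) = {a, d}\<close> by simp
  qed (rule nonisolated)
  have ends: "(\<exists>c. J = {a, c}) \<or> (\<exists>c. J = {b, c})"
    if "J \<in> {g (leg_start n), g (LeafB 1), g (LeafB 2)}" for J
  proof -
    have "({a, b}, J) \<in> parcs (TS2 G)"
      using that z[of J] ab by simp
    then show ?thesis
      by (rule TS2_arcE[OF _ refl]) blast+
  qed
  have ba: "g (Path n) = {b, a}"
    using ab by auto
  \<comment> \<open>Two leaves at the same end are refuted by \<open>same\<close>. In the mixed
    cases the end kept by the leg decides between \<open>finish\<close> with \<open>ab\<close> and
    with \<open>ba\<close>.\<close>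
  consider c d where "g (LeafB 1) = {a, c}" "g (LeafB 2) = {a, d}"
    | c d where "g (LeafB 1) = {b, c}" "g (LeafB 2) = {b, d}"
    | c d where "g (LeafB 1) = {a, c}" "g (LeafB 2) = {b, d}"
    | c d where "g (LeafB 1) = {b, c}" "g (LeafB 2) = {a, d}"
    using ends[of "g (LeafB 1)"] ends[of "g (LeafB 2)"] by blast
  then show ?thesis
  proof cases
    case 3
    show ?thesis
      using ends[of "g (leg_start n)"] finish[OF ab _ 3(1,2)] finish[OF ba _ 3(2,1)]
      by (auto simp: insert_commute)
  next
    case 4
    show ?thesis
      using ends[of "g (leg_start n)"] finish[OF ab _ 4(2,1)] finish[OF ba _ 4(1,2)]
      by (auto simp: insert_commute)
  qed (use same[OF ab] same[OF ba] in blast)+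
qed

section \<open>The graph realising \<open>n = 3\<close>\<close>

text \<open>The complement is given first, as its edges are the nodes: the triangle
  \<open>0, 2, 3\<close> with the path \<open>0, 1, 4\<close> and the edge \<open>2, 5\<close>
  attached. In the earlier letters \<open>a, b, p, c, d\<close> are
  \<open>0, 1, 2, 3, 4\<close>.\<close>

definition G3_non_edges :: "nat set set" where
  "G3_non_edges = {{0, 1}, {1, 4}, {0, 2}, {0, 3}, {2, 3}, {2, 5}}"

definition G3 :: "nat pair_pre_digraph" where
  "G3 = \<lparr>pverts = {0..5}, parcs = {(u, v). u \<in> {0..5} \<and> v \<in> {0..5} \<and> u \<noteq> v \<and> {u, v} \<notin> G3_non_edges}\<rparr>"

lemma pair_graph_G3: "pair_graph G3"
  by (rule pair_graphI) (auto simp: G3_def insert_commute)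

lemma TS2_nodes_G3: "TS2_nodes G3 = G3_non_edges"
proof -
  interpret pair_graph G3 by (rule pair_graph_G3)
  have 1: "nonadj G3 u v \<longleftrightarrow> {u, v} \<in> G3_non_edges" for u v
    by (auto simp: nonadj_def G3_def G3_non_edges_def doubleton_eq_iff)
  have 2: "I \<in> G3_non_edges \<Longrightarrow> \<exists>u v. I = {u, v}" for I
    by (auto simp: G3_non_edges_def)
  show ?thesis
    using 1 2 doubleton_TS2_nodes by (metis TS2_nodesE subsetI subset_antisym)
qed

text \<open>The centre goes to \<open>ab\<close>, \<open>leg_start 3\<close> to \<open>ap\<close>
  and \<open>LeafA 1\<close> to \<open>pc\<close>. The final \<open>else\<close> branches serve
  \<open>Path 1\<close> and \<open>LeafB 2\<close>.\<close>

fun D3_map :: "D_vertex \<Rightarrow> nat set" where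
  "D3_map (Path i) = (if i = 3 then {0, 1} else if i = 2 then {0, 2} else {2, 5})"
| "D3_map (LeafA i) = {2, 3}"
| "D3_map (LeafB i) = (if i = 1 then {0, 3} else {1, 4})"

lemma is_TS2_graph_D3: "is_TS2_graph (D 1 3 2)"
proof -
  have V: "pverts (D 1 3 2) = {Path 1, Path 2, Path 3, LeafA 1, LeafB 1, LeafB 2}"
    by (auto simp: D_def image_iff)
  have nodes: "TS2_nodes G3 = D3_map ` pverts (D 1 3 2)"
    unfolding V by (simp add: TS2_nodes_G3 G3_non_edges_def insert_commute)
  \<comment> \<open>A finite check over all 36 pairs of tree vertices.\<close>
  have "\<forall>x\<in>pverts (D 1 3 2). \<forall>y\<in>pverts (D 1 3 2).
      (\<exists>u v. D3_map x - D3_map y = {u} \<and> D3_map y - D3_map x = {v} \<and> (u, v) \<in> parcs G3) \<longleftrightarrow>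
      (x, y) \<in> parcs (D 1 3 2)"
    unfolding V by (simp add: D_arc_iff insert_Diff_if G3_def G3_non_edges_def doubleton_eq_iff)
  then have arc: "(D3_map x, D3_map y) \<in> parcs (TS2 G3) \<longleftrightarrow> (x, y) \<in> parcs (D 1 3 2)"
    if "x \<in> pverts (D 1 3 2)" "y \<in> pverts (D 1 3 2)" for x y
    using that by (simp add: TS2_def nodes)
  have arcs: "parcs (TS2 G3) = map_prod D3_map D3_map ` parcs (D 1 3 2)"
  proof (intro equalityI subsetI)
    fix e assume e: "e \<in> parcs (TS2 G3)"
    then have "fst e \<in> TS2_nodes G3" "snd e \<in> TS2_nodes G3"
      using parcs_TS2D[of "fst e" "snd e" G3] by simp_all
    then obtain x y where xy: "fst e = D3_map x" "snd e = D3_map y"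
      "x \<in> pverts (D 1 3 2)" "y \<in> pverts (D 1 3 2)"
      unfolding nodes by blast
    then have "e = map_prod D3_map D3_map (x, y)" "(x, y) \<in> parcs (D 1 3 2)"
      using e arc[OF xy(3,4)] by (simp_all add: prod_eq_iff flip: xy(1,2))
    then show "e \<in> map_prod D3_map D3_map ` parcs (D 1 3 2)"
      by (rule image_eqI)
  next
    interpret pair_graph "D 1 3 2"
      by (rule pair_graph_D) simp
    fix e assume "e \<in> map_prod D3_map D3_map ` parcs (D 1 3 2)"
    then obtain x y where "e = (D3_map x, D3_map y)" "(x, y) \<in> parcs (D 1 3 2)"
      by auto
    then show "e \<in> parcs (TS2 G3)"
      using arc in_arcsD1 in_arcsD2 by blast
  qed
  \<comment> \<open>\<open>D3_map\<close> starts from the tree, so the isomorphism is built in this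
    direction and reversed afterwards.\<close>
  have "digraph_iso (with_proj (D 1 3 2)) (with_proj (TS2 G3))"
  proof (rule digraph_iso_with_projI)
    show "pair_graph (D 1 3 2)"
      by (simp add: pair_graph_D)
    show "inj_on D3_map (pverts (D 1 3 2))"
      unfolding V by (simp add: inj_on_def doubleton_eq_iff)
    show "pverts (TS2 G3) = D3_map ` pverts (D 1 3 2)"
      by (simp add: TS2_def nodes)
  qed (rule arcs)
  moreover have "wf_digraph (with_proj (D 1 3 2))"
    using pair_graph_D[of 3 1 2]
    by (simp add: wf_digraph_wp_iff pair_graph_def pair_digraph_def pair_fin_digraph_def)
  ultimately show ?thesis
    using digraph_iso_swap pair_graph_G3 by (auto simp: is_TS2_graph_def)
qed

theorem proposition29:
  fixes n :: nat
  assumes "n \<ge> 1"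
  shows "is_TS2_graph (D 1 n 2) \<longleftrightarrow> n = 3"
  using is_TS2_graph_D_imp[OF assms] is_TS2_graph_D3 by blast

end
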